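(* Let $P$ be a probability law on $\mathbb{R}$ with continuous CDF $F=F_P$ and density $f$ positive at its median $m=F^{-1}(1/2)$. Define the frozen oracle functional (only the averaging law $Q$ varies, the chart remains frozen at $F_P$) $$T_P^{\mathrm{fr}}(Q)=F_P^{-1}\left(\mathbb{E}_Q[F_P(X)]\right)$$ and the self-induced intrinsic functional $$T^{\mathrm{int}}(Q)=F_Q^{-1}\left(\mathbb{E}_Q[F_Q(X)]\right)=F_Q^{-1}(1/2),$$ that is, the median functional. Then $$\operatorname{IF}(x;T_P^{\mathrm{fr}},P)=\frac{F(x)-1/2}{f(m)},\qquad \mathbb{E}_P\left[\operatorname{IF}(X;T_P^{\mathrm{fr}},P)^2\right]=\frac1{12f(m)^2},$$ whereas $$\operatorname{IF}(x;T^{\mathrm{int}},P)=\frac{1/2-\mathbf 1_{(-\infty,m]}(x)}{f(m)},\qquad \mathbb{E}_P\left[\operatorname{IF}(X;T^{\mathrm{int}},P)^2\right]=\frac1{4f(m)^2}.$$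
   Context: For a probability law $Q$ on $\mathbb{R}$, $F_Q$ denotes its CDF, $F_Q^{-1}$ its (generalised) inverse, and $\mathbb{E}_Q$ expectation when $X\sim Q$. $\operatorname{IF}(x;T,P)$ denotes the influence function of the functional $T$ at $P$, i.e. $\lim_{\varepsilon\downarrow0}\varepsilon^{-1}\{T((1-\varepsilon)P+\varepsilon\delta_x)-T(P)\}$ with $\delta_x$ the point mass at $x$.
   Formalization: The formula for IF(x;T^int,P) is proved for x ≠ m (at x = m the IF is 0); f(m) is taken to be F'(m); E_Q[F_Q(X)] = 1/2 and T^int = median are claimed only for continuous F_Q (false with atoms), and the IF claims are proved for both functionals. *)

theory Defs
  imports "HOL-Probability.Probability"
begin

text \<open>The left-continuous generalised inverse of the CDF. It is the infimum of a nonempty set that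
  is bounded below for every level \<open>0 < u < 1\<close>, and only such levels matter for the limits below.\<close>

definition cdf_inv :: "real measure \<Rightarrow> real \<Rightarrow> real" where
  "cdf_inv Q u = Inf {t. u \<le> cdf Q t}"

definition median :: "real measure \<Rightarrow> real" where
  "median Q = cdf_inv Q (1/2)"

definition T_frozen :: "real measure \<Rightarrow> real measure \<Rightarrow> real" where
  "T_frozen P Q = cdf_inv P (integral\<^sup>L Q (cdf P))"

text \<open>The intrinsic functional evaluates the (right-continuous) CDF of the law itself. If \<open>Q\<close> has
  atoms, then the mean of \<open>cdf Q\<close> under \<open>Q\<close> exceeds \<open>1/2\<close>, so \<open>T_int Q\<close> and \<open>median Q\<close> may differ;
  they agree when \<open>cdf Q\<close> is continuous. The contaminated laws below have an atom at \<open>x\<close>, so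
  influence functions are considered for both. If \<open>x\<close> is the median \<open>m\<close> of \<open>P\<close>, then the contaminated
  CDF jumps across the level at \<open>m\<close>, so both functionals stay at \<open>m\<close> and their influence function
  is 0 there, not \<open>-1 / (2 * f m)\<close>; hence \<open>x = m\<close> is excluded from the formula.\<close>

definition T_int :: "real measure \<Rightarrow> real" where
  "T_int Q = cdf_inv Q (integral\<^sup>L Q (cdf Q))"

text \<open>The law \<open>(1 - \<epsilon>) P + \<epsilon> \<delta>\<^sub>x\<close>, for \<open>0 \<le> \<epsilon> \<le> 1\<close>.\<close>

definition contaminate :: "real measure \<Rightarrow> real \<Rightarrow> real \<Rightarrow> real measure" where
  "contaminate P x \<epsilon> = measure_of UNIV (sets borel)
     (\<lambda>A. ennreal (1 - \<epsilon>) * emeasure P A + ennreal \<epsilon> * emeasure (return borel x) A)"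

definition has_IF :: "(real measure \<Rightarrow> real) \<Rightarrow> real measure \<Rightarrow> real \<Rightarrow> real \<Rightarrow> bool" where
  "has_IF T P x v \<longleftrightarrow>
     ((\<lambda>\<epsilon>. (T (contaminate P x \<epsilon>) - T P) / \<epsilon>) \<longlongrightarrow> v) (at_right 0)"

definition IF :: "(real measure \<Rightarrow> real) \<Rightarrow> real measure \<Rightarrow> real \<Rightarrow> real" where
  "IF T P x = Lim (at_right 0) (\<lambda>\<epsilon>. (T (contaminate P x \<epsilon>) - T P) / \<epsilon>)"

lemma has_IF_imp_IF: "has_IF T P x v \<Longrightarrow> IF T P x = v"
  unfolding has_IF_def IF_def by (rule tendsto_Lim) simp_all

lemma sets_contaminate [simp, measurable_cong]: "sets (contaminate P x \<epsilon>) = sets borel"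
  unfolding contaminate_def using sets.sigma_sets_eq[of "borel :: real measure"] by simp

lemma emeasure_contaminate:
  assumes P: "sets P = sets borel" and A: "A \<in> sets borel"
  shows "emeasure (contaminate P x \<epsilon>) A =
    ennreal (1 - \<epsilon>) * emeasure P A + ennreal \<epsilon> * emeasure (return borel x) A"
proof (rule emeasure_measure_of[OF contaminate_def])
  show "countably_additive (sets (contaminate P x \<epsilon>))
      (\<lambda>A. ennreal (1 - \<epsilon>) * emeasure P A + ennreal \<epsilon> * emeasure (return borel x) A)"
    using P by (auto simp: countably_additive_def suminf_add[symmetric] suminf_emeasure suminf_indicator)
qed (use A in \<open>auto simp: positive_def\<close>)

lemma real_distribution_contaminate:
  assumes P: "real_distribution P" and e: "0 \<le> \<epsilon>" "\<epsilon> \<le> 1"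
  shows "real_distribution (contaminate P x \<epsilon>)"
proof -
  interpret P: real_distribution P by (rule P)
  have sp: "space (contaminate P x \<epsilon>) = UNIV"
    using sets_eq_imp_space_eq[OF sets_contaminate] by simp
  have "emeasure P UNIV = 1" using P.emeasure_space_1 by simp
  then have "emeasure (contaminate P x \<epsilon>) UNIV = 1"
    using e by (simp add: emeasure_contaminate flip: ennreal_plus)
  then show ?thesis
    by (intro real_distribution.intro prob_spaceI real_distribution_axioms.intro)
      (simp_all add: sp)
qed

text \<open>The density at a point is taken to be the derivative of the CDF there. A Lebesgue density that
  is continuous at the point is a special case.\<close>

lemma lebesgue_density_imp_cdf_derivative:
  assumes P: "real_distribution P" and dens: "P = density lborel (\<lambda>x. ennreal (f x))"
    and meas: "f \<in> borel_measurable borel" and nonneg: "\<And>x. f x \<ge> 0" and cont: "isCont f x"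
  shows "(cdf P has_real_derivative f x) (at x)"
proof -
  interpret P: real_distribution P by (rule P)
  have int: "integrable lborel f"
  proof (rule integrableI_nonneg)
    have "emeasure P UNIV = (\<integral>\<^sup>+x. ennreal (f x) \<partial>lborel)"
      unfolding dens using meas by (simp add: emeasure_density)
    then show "(\<integral>\<^sup>+x. ennreal (f x) \<partial>lborel) < \<infinity>"
      using P.emeasure_space_1 by simp
  qed (use meas nonneg in auto)
  have si: "set_integrable lborel A f" if "A \<in> sets borel" for A
    using int that unfolding set_integrable_def by (intro integrable_mult_indicator) auto
  have meq: "measure P A = (LINT y:A|lborel. f y)" if "A \<in> sets borel" for A
  proof -
    have "emeasure P A = (\<integral>\<^sup>+y. ennreal (indicator A y * f y) \<partial>lborel)"
      unfolding dens using meas that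
      by (subst emeasure_density) (auto intro!: nn_integral_cong split: split_indicator)
    also have "\<dots> = ennreal (LINT y:A|lborel. f y)"
      unfolding set_lebesgue_integral_def
      using si[OF that] nonneg
      by (subst nn_integral_eq_integral) (auto simp: set_integrable_def)
    finally show ?thesis
      unfolding measure_def
      by (simp add: set_lebesgue_integral_def nonneg integral_nonneg_AE)
  qed
  have eq: "cdf P u = cdf P (x - 1) + integral {x - 1..u} f" if "x - 1 < u" for u
  proof -
    have "cdf P u - cdf P (x - 1) = measure P {x - 1<..u}"
      using that by (rule P.cdf_diff_eq)
    also have "\<dots> = (LINT y:{x - 1<..u}|lborel. f y)" by (rule meq) simp
    also have "\<dots> = integral {x - 1<..u} f"
      by (rule set_borel_integral_eq_integral(2)[OF si]) simp
    also have "\<dots> = integral {x - 1..u} f"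
    proof (rule integral_spike_set)
      show "negligible {y \<in> {x - 1<..u} - {x - 1..u}. f y \<noteq> 0}"
        by (rule negligible_subset[OF negligible_empty]) auto
      show "negligible {y \<in> {x - 1..u} - {x - 1<..u}. f y \<noteq> 0}"
        by (rule negligible_subset[OF negligible_sing[of "x - 1"]]) auto
    qed
    finally show ?thesis by simp
  qed
  have "f integrable_on {x - 1..x + 1}"
    by (rule set_borel_integral_eq_integral(1)[OF si]) simp
  from integral_has_vector_derivative_continuous_at[OF this, of x "{}"] cont
  have "((\<lambda>u. integral {x - 1..u} f) has_vector_derivative f x) (at x within {x - 1..x + 1})"
    by (simp add: continuous_at_imp_continuous_at_within)
  then have "((\<lambda>u. integral {x - 1..u} f) has_real_derivative f x) (at x)"
    by (simp add: has_real_derivative_iff_has_vector_derivative at_within_Icc_at)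
  then have "((\<lambda>u. cdf P (x - 1) + integral {x - 1..u} f) has_real_derivative f x) (at x)"
    by (auto intro!: derivative_eq_intros)
  then show ?thesis
  proof (rule DERIV_cong_ev[THEN iffD1, rotated -1])
    show "\<forall>\<^sub>F u in nhds x. cdf P (x - 1) + integral {x - 1..u} f = cdf P u"
      using eventually_nhds_in_open[of "{x - 1<..}" x] by (auto elim!: eventually_mono simp: eq)
  qed simp_all
qed

end

theory Submission
  imports Defs
begin

text \<open>For continuous \<open>F\<close> the variable \<open>F(X)\<close> is uniform on \<open>[0, 1]\<close>, so it has mean \<open>1/2\<close> and variance
  \<open>1/12\<close>. Each functional is a quantile at a moving level: the frozen one is the quantile of \<open>P\<close> at
  level \<open>1/2 + \<epsilon> (F(x) - 1/2)\<close>, the intrinsic one is the quantile of the contaminated law at level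
  \<open>1/2 + \<epsilon>\<^sup>2 / 2\<close>, the excess being half the squared mass of the atom, which is of second order. All
  limits then follow from one first-order criterion for quantiles, which only uses the derivative of
  \<open>F\<close> at \<open>m\<close>.\<close>

section \<open>Quantiles of one law and the uniformity of \<open>F(X)\<close>\<close>

context real_distribution
begin

text \<open>\<open>0 < u\<close> makes the set under the infimum bounded below. This bound and its
  counterpart \<open>le_cdf_inv\<close>, where \<open>u < 1\<close> makes the set nonempty, are
  stated for arbitrary laws because they are applied to contaminated laws, which have an
  atom.\<close>

lemma cdf_inv_le:
  assumes "0 < u" "u \<le> cdf M t"
  shows "cdf_inv M u \<le> t"
proof -
  obtain b where b: "cdf M b < u"
    using order_tendstoD(2)[OF cdf_lim_at_bot \<open>0 < u\<close>] by (auto simp: eventually_at_bot_linorder)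
  have "b \<le> s" if "u \<le> cdf M s" for s
    using that b cdf_nondecreasing[of s b] by linarith
  then show ?thesis
    unfolding cdf_inv_def using assms(2) by (intro cInf_lower bdd_belowI[of _ b]) auto
qed

lemma le_cdf_inv:
  assumes "u < 1" "cdf M t < u"
  shows "t \<le> cdf_inv M u"
proof -
  obtain b where b: "u < cdf M b"
    using order_tendstoD(1)[OF cdf_lim_at_top_prob \<open>u < 1\<close>] by (auto simp: eventually_at_top_linorder)
  have "t \<le> s" if "u \<le> cdf M s" for s
    using that assms(2) cdf_nondecreasing[of s t] by linarith
  then show ?thesis
    unfolding cdf_inv_def using b by (intro cInf_greatest) (auto intro: less_imp_le)
qed

lemma cdf_attains:
  assumes "continuous_on UNIV (cdf M)" "0 < u" "u < 1"
  obtains t where "cdf M t = u"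
proof -
  obtain a where a: "cdf M a < u"
    using order_tendstoD(2)[OF cdf_lim_at_bot \<open>0 < u\<close>] by (auto simp: eventually_at_bot_linorder)
  obtain b where b: "u < cdf M b"
    using order_tendstoD(1)[OF cdf_lim_at_top_prob \<open>u < 1\<close>] by (auto simp: eventually_at_top_linorder)
  have "a \<le> b" using a b cdf_nondecreasing[of b a] by linarith
  then show ?thesis
    using IVT'[of "cdf M" a u b] a b continuous_on_subset[OF assms(1)] that by auto
qed

lemma cdf_cdf_inv:
  assumes cont: "continuous_on UNIV (cdf M)" and u: "0 < u" "u < 1"
  shows "cdf M (cdf_inv M u) = u"
proof (rule antisym)
  obtain s where s: "cdf M s = u" using cdf_attains[OF assms] .
  have "cdf_inv M u \<le> s" using s u by (intro cdf_inv_le) auto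
  then show "cdf M (cdf_inv M u) \<le> u" using cdf_nondecreasing s by blast
  show "u \<le> cdf M (cdf_inv M u)"
  proof (rule ccontr)
    assume "\<not> u \<le> cdf M (cdf_inv M u)"
    \<comment> \<open>The midpoint is attained at some \<open>t\<close>. Being below
      \<open>u\<close>, it forces \<open>t\<close> to lie at or left of the quantile; exceeding the
      CDF there, it then contradicts monotonicity.\<close>
    then have "cdf M (cdf_inv M u) < (cdf M (cdf_inv M u) + u) / 2"
      "(cdf M (cdf_inv M u) + u) / 2 < u" by auto
    moreover obtain t where t: "cdf M t = (cdf M (cdf_inv M u) + u) / 2"
    proof (rule cdf_attains[OF cont])
      show "0 < (cdf M (cdf_inv M u) + u) / 2" using cdf_nonneg[of "cdf_inv M u"] u by simp
      show "(cdf M (cdf_inv M u) + u) / 2 < 1" using calculation u by linarith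
    qed
    ultimately show False
      using le_cdf_inv[of u t] cdf_nondecreasing[of t "cdf_inv M u"] u by linarith
  qed
qed

text \<open>By continuity and monotonicity, a nonempty sublevel set for \<open>u < 1\<close> is a
  closed ray ending at its supremum, even if the CDF has plateaus. Its probability is the CDF at
  that endpoint, and this is \<open>u\<close> because any point attaining \<open>u\<close> belongs
  to the ray.\<close>

lemma prob_cdf_le:
  assumes cont: "continuous_on UNIV (cdf M)" and u: "0 \<le> u" "u \<le> 1"
  shows "prob {x. cdf M x \<le> u} = u"
proof -
  define A where "A = {x. cdf M x \<le> u}"
  consider "u = 1" | "u < 1" "A = {}" | "u < 1" "A \<noteq> {}" using u by force
  then show ?thesis
  proof cases
    case 1
    then have "A = UNIV" using cdf_bounded_prob unfolding A_def by auto
    then show ?thesis using 1 prob_space unfolding A_def by simp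
  next
    case 2
    \<comment> \<open>The CDF exceeds \<open>u\<close> everywhere yet tends to 0 on the left, so
      only \<open>u = 0\<close> is possible.\<close>
    have "u \<le> 0"
      using 2(2) unfolding A_def
      by (intro tendsto_lowerbound[OF cdf_lim_at_bot]) (auto intro!: always_eventually less_imp_le simp: not_le)
    then show ?thesis using u 2 unfolding A_def by simp
  next
    case 3
    obtain b where b: "u < cdf M b"
      using order_tendstoD(1)[OF cdf_lim_at_top_prob \<open>u < 1\<close>] by (auto simp: eventually_at_top_linorder)
    have "y \<le> b" if "y \<in> A" for y
      using that b cdf_nondecreasing[of b y] unfolding A_def by force
    then have bdd: "bdd_above A" by (rule bdd_aboveI)
    have "closed A" unfolding A_def by (intro closed_Collect_le cont continuous_on_const)
    then have mem: "Sup A \<in> A" by (rule closed_contains_Sup[OF 3(2) bdd])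
    have A: "A = {..Sup A}"
      using mem cdf_nondecreasing cSup_upper[OF _ bdd] unfolding A_def by (auto intro: order_trans)
    have "cdf M (Sup A) = u"
    proof (rule ccontr)
      assume "cdf M (Sup A) \<noteq> u"
      then have less: "cdf M (Sup A) < u" using mem unfolding A_def by auto
      then have "0 < u" using cdf_nonneg[of "Sup A"] by linarith
      then obtain t where t: "cdf M t = u" using cdf_attains[OF cont] 3(1) by blast
      then have "t \<le> Sup A" using A unfolding A_def by auto
      then show False using cdf_nondecreasing[of t "Sup A"] t less by simp
    qed
    then show ?thesis using A unfolding A_def cdf_def by metis
  qed
qed

text \<open>The probability integral transform. The normalising constant is 1, kept in the shape
  that the moment formulas for uniform variables expect.\<close>

lemma cdf_distributed_uniform:
  assumes "continuous_on UNIV (cdf M)"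
  shows "distributed M lborel (cdf M) (\<lambda>x. indicator {0..1} x / measure lborel {0..1::real})"
  using prob_cdf_le[OF assms] borel_measurable_continuous_onI[OF assms]
  by (intro uniform_distrI_borel_atLeastAtMost) auto

lemma cdf_measurable [measurable]: "cdf M \<in> borel_measurable borel"
  by (rule borel_measurable_mono) (auto simp: mono_def cdf_nondecreasing)

lemma integrable_bounded:
  assumes "g \<in> borel_measurable borel" "\<And>x. \<bar>g x\<bar> \<le> (B :: real)"
  shows "integrable M g"
  using assms by (intro integrable_const_bound[where B = B]) auto

lemma expectation_cdf:
  assumes "continuous_on UNIV (cdf M)"
  shows "expectation (cdf M) = 1/2"
  using uniform_distributed_expectation[OF cdf_distributed_uniform[OF assms]] by simp

lemma variance_cdf:
  assumes "continuous_on UNIV (cdf M)"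
  shows "variance (cdf M) = 1/12"
  using uniform_distributed_variance[OF cdf_distributed_uniform[OF assms]] by simp

lemma T_int_eq_median:
  assumes "continuous_on UNIV (cdf M)"
  shows "T_int M = median M"
  by (simp add: T_int_def median_def expectation_cdf[OF assms])

section \<open>CDF and integrals of the contaminated law\<close>

lemma cdf_contaminate:
  assumes "0 \<le> \<epsilon>" "\<epsilon> \<le> 1"
  shows "cdf (contaminate M x \<epsilon>) t = (1 - \<epsilon>) * cdf M t + \<epsilon> * indicator {..t} x"
proof -
  have "emeasure (contaminate M x \<epsilon>) {..t} = ennreal ((1 - \<epsilon>) * cdf M t + \<epsilon> * indicator {..t} x)"
    using assms
    by (subst emeasure_contaminate)
      (auto simp: emeasure_eq_measure cdf_def ennreal_mult'' ennreal_plus split: split_indicator)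
  moreover have "0 \<le> (1 - \<epsilon>) * cdf M t + \<epsilon> * indicator {..t} x"
    using assms by (auto simp: cdf_nonneg)
  ultimately show ?thesis
    unfolding cdf_def[of "contaminate M x \<epsilon>"] measure_def by (simp only: enn2real_ennreal)
qed

text \<open>On indicators this is \<open>emeasure_contaminate\<close>; sums, scalings and increasing
  limits preserve it.\<close>

lemma nn_integral_contaminate:
  assumes "g \<in> borel_measurable borel"
  shows "(\<integral>\<^sup>+y. g y \<partial>contaminate M x \<epsilon>) = ennreal (1 - \<epsilon>) * (\<integral>\<^sup>+y. g y \<partial>M) + ennreal \<epsilon> * g x"
  using assms
proof (induction rule: borel_measurable_induct)
  case (cong f g)
  then show ?case by (simp add: fun_eq_iff cong: nn_integral_cong)
next
  case (set A)
  then show ?case by (simp add: emeasure_contaminate)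
next
  case (mult u c)
  then show ?case
    by (simp add: nn_integral_cmult distrib_left mult.left_commute measurable_cong_sets[OF sets_contaminate refl])
next
  case (add u v)
  then show ?case
    by (simp add: nn_integral_add distrib_left ac_simps measurable_cong_sets[OF sets_contaminate refl])
next
  case (seq U)
  have "(\<integral>\<^sup>+y. (SUP i. U i) y \<partial>contaminate M x \<epsilon>) = (SUP i. \<integral>\<^sup>+y. U i y \<partial>contaminate M x \<epsilon>)"
    unfolding SUP_apply using seq
    by (intro nn_integral_monotone_convergence_SUP) (simp_all add: measurable_cong_sets[OF sets_contaminate refl])
  also have "\<dots> = (SUP i. ennreal (1 - \<epsilon>) * (\<integral>\<^sup>+y. U i y \<partial>M) + ennreal \<epsilon> * U i x)"
    using seq by (simp add: SUP_apply)
  \<comment> \<open>The supremum splits over the sum because both summands increase with the same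
    index.\<close>
  also have "\<dots> = ennreal (1 - \<epsilon>) * (SUP i. \<integral>\<^sup>+y. U i y \<partial>M) + ennreal \<epsilon> * (SUP i. U i x)"
    using seq by (subst ennreal_SUP_add)
      (auto simp: SUP_mult_left_ennreal incseq_def le_fun_def intro!: mult_left_mono nn_integral_mono)
  also have "(SUP i. \<integral>\<^sup>+y. U i y \<partial>M) = (\<integral>\<^sup>+y. (SUP i. U i) y \<partial>M)"
    unfolding SUP_apply using seq
    by (intro nn_integral_monotone_convergence_SUP[symmetric]) simp_all
  finally show ?case by (simp only: SUP_apply)
qed

text \<open>Nonnegativity reduces this to the nonnegative integral, and suffices because the
  integrands of interest are CDFs.\<close>

lemma integral_contaminate:
  assumes g [measurable]: "g \<in> borel_measurable borel" and nonneg: "\<And>y. 0 \<le> g y" and int: "integrable M g"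
    and e: "0 \<le> \<epsilon>" "\<epsilon> \<le> 1"
  shows "(\<integral>y. g y \<partial>contaminate M x \<epsilon>) = (1 - \<epsilon>) * (\<integral>y. g y \<partial>M) + \<epsilon> * g x"
proof -
  have "(\<integral>\<^sup>+y. ennreal (g y) \<partial>contaminate M x \<epsilon>) = ennreal ((1 - \<epsilon>) * (\<integral>y. g y \<partial>M) + \<epsilon> * g x)"
    using e nonneg Bochner_Integration.integral_nonneg[of M g]
    by (simp add: nn_integral_contaminate nn_integral_eq_integral[OF int] ennreal_mult'' ennreal_plus)
  moreover have "0 \<le> (1 - \<epsilon>) * (\<integral>y. g y \<partial>M) + \<epsilon> * g x"
    using e nonneg by auto
  moreover have "g \<in> borel_measurable (contaminate M x \<epsilon>)"
    by (simp add: measurable_cong_sets[OF sets_contaminate refl])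
  ultimately show ?thesis
    using nonneg by (simp only: integral_eq_nn_integral always_eventually enn2real_ennreal simp_thms)
qed

lemma integral_contaminate_cdf:
  assumes cont: "continuous_on UNIV (cdf M)" and e: "0 \<le> \<epsilon>" "\<epsilon> \<le> 1"
  shows "(\<integral>y. cdf M y \<partial>contaminate M x \<epsilon>) = 1/2 + \<epsilon> * (cdf M x - 1/2)"
proof -
  have "integrable M (cdf M)"
    by (rule integrable_bounded[of _ 1]) (auto simp: cdf_nonneg cdf_bounded_prob)
  then show ?thesis
    by (simp add: integral_contaminate e cdf_nonneg expectation_cdf[OF cont] field_simps)
qed

text \<open>The terms in \<open>cdf M x\<close> from the two components cancel, leaving \<open>(1 -
  \<epsilon>)\<^sup>2 / 2 + \<epsilon> * (1 - \<epsilon>) + \<epsilon>\<^sup>2\<close>, independent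
  of \<open>x\<close>.\<close>

lemma integral_contaminate_cdf_contaminate:
  assumes cont: "continuous_on UNIV (cdf M)" and e: "0 \<le> \<epsilon>" "\<epsilon> \<le> 1"
  shows "(\<integral>y. cdf (contaminate M x \<epsilon>) y \<partial>contaminate M x \<epsilon>) = 1/2 + \<epsilon>\<^sup>2 / 2"
proof -
  interpret Q: real_distribution "contaminate M x \<epsilon>"
    by (rule real_distribution_contaminate[OF real_distribution_axioms e])
  let ?G = "cdf (contaminate M x \<epsilon>)"
  have iF: "integrable M (cdf M)"
    by (rule integrable_bounded[of _ 1]) (auto simp: cdf_nonneg cdf_bounded_prob)
  have iG: "integrable M ?G"
    by (rule integrable_bounded[of _ 1]) (auto simp: Q.cdf_nonneg Q.cdf_bounded_prob)
  \<comment> \<open>Without an atom at \<open>x\<close>, the closed upper ray has mass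
    \<open>1 - cdf M x\<close>.\<close>
  have "prob {x} = 0"
    using cont by (simp add: isCont_cdf[symmetric] continuous_on_eq_continuous_at)
  moreover have "{x..} = {x} \<union> {x<..}" "UNIV - {..x} = {x<..}" by auto
  ultimately have "prob {x..} = 1 - cdf M x"
    using finite_measure_Union[of "{x}" "{x<..}"] prob_compl[of "{..x}"] by (simp add: cdf_def)
  moreover have ind: "indicator {..y} x = indicator {x..} y" for y :: real
    by (auto split: split_indicator)
  moreover have "integrable M (indicator {x..} :: real \<Rightarrow> real)"
    by (rule integrable_bounded[of _ 1]) (auto simp: indicator_def)
  ultimately have "(\<integral>y. ?G y \<partial>M) = (1 - \<epsilon>) / 2 + \<epsilon> * (1 - cdf M x)"
    using iF by (simp add: cdf_contaminate[OF e] ind expectation_cdf[OF cont])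
  moreover have "(\<integral>y. ?G y \<partial>contaminate M x \<epsilon>) = (1 - \<epsilon>) * (\<integral>y. ?G y \<partial>M) + \<epsilon> * ?G x"
    by (rule integral_contaminate) (auto simp: iG e Q.cdf_nonneg)
  ultimately show ?thesis
    by (simp only: cdf_contaminate[OF e, of x x]) (simp add: power2_eq_square field_simps)
qed

end

section \<open>First-order behaviour of moving quantiles\<close>

text \<open>Testing the perturbed CDF on the rays \<open>m + c * \<epsilon>\<close> brackets the quantile between rays of slope
  arbitrarily close to \<open>v\<close>, so no inverse function is differentiated.\<close>

lemma cdf_inv_slope_tendsto:
  fixes Q :: "real \<Rightarrow> real measure"
  assumes dist: "\<forall>\<^sub>F \<epsilon> in at_right 0. real_distribution (Q \<epsilon>)"
    and u: "(u \<longlongrightarrow> l) (at_right 0)" "0 < l" "l < 1" and k: "k > 0"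
    and slope: "\<And>c. ((\<lambda>\<epsilon>. (cdf (Q \<epsilon>) (m + c * \<epsilon>) - u \<epsilon>) / \<epsilon>) \<longlongrightarrow> k * (c - v)) (at_right 0)"
  shows "((\<lambda>\<epsilon>. (cdf_inv (Q \<epsilon>) (u \<epsilon>) - m) / \<epsilon>) \<longlongrightarrow> v) (at_right 0)"
proof (rule order_tendstoI)
  have pos: "\<forall>\<^sub>F \<epsilon> in at_right (0::real). 0 < \<epsilon>" by (rule eventually_at_right_less)
  \<comment> \<open>The level stays inside the open unit interval, where both quantile bounds
    apply.\<close>
  note u01 = order_tendstoD(1)[OF u(1,2)] order_tendstoD(2)[OF u(1,3)]
  fix a
  {
    assume "a < v"
    then obtain c where c: "a < c" "c < v" using dense by blast
    \<comment> \<open>A negative limit puts the CDF on the ray below the level, so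
      \<open>le_cdf_inv\<close> applies; the other case mirrors this with
      \<open>cdf_inv_le\<close>.\<close>
    have "k * (c - v) < 0" using c k by (simp add: mult_pos_neg)
    from order_tendstoD(2)[OF slope this] dist pos u01
    show "\<forall>\<^sub>F \<epsilon> in at_right 0. a < (cdf_inv (Q \<epsilon>) (u \<epsilon>) - m) / \<epsilon>"
    proof eventually_elim
      case (elim \<epsilon>)
      have "m + c * \<epsilon> \<le> cdf_inv (Q \<epsilon>) (u \<epsilon>)"
        using elim by (intro real_distribution.le_cdf_inv) (auto simp: divide_less_0_iff)
      then have "c \<le> (cdf_inv (Q \<epsilon>) (u \<epsilon>) - m) / \<epsilon>" using elim by (simp add: field_simps)
      then show ?case using c by simp
    qed
  next
    assume "v < a"
    then obtain c where c: "v < c" "c < a" using dense by blast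
    have "0 < k * (c - v)" using c k by simp
    from order_tendstoD(1)[OF slope this] dist pos u01
    show "\<forall>\<^sub>F \<epsilon> in at_right 0. (cdf_inv (Q \<epsilon>) (u \<epsilon>) - m) / \<epsilon> < a"
    proof eventually_elim
      case (elim \<epsilon>)
      have "cdf_inv (Q \<epsilon>) (u \<epsilon>) \<le> m + c * \<epsilon>"
        using elim by (intro real_distribution.cdf_inv_le) (auto simp: zero_less_divide_iff)
      then have "(cdf_inv (Q \<epsilon>) (u \<epsilon>) - m) / \<epsilon> \<le> c" using elim by (simp add: field_simps)
      then show ?case using c by simp
    qed
  }
qed

text \<open>For \<open>c < 0\<close> the ray reaches \<open>m\<close> from the left, so the
  two-sided derivative enters; the chain rule treats all signs of \<open>c\<close> at once.\<close>

lemma has_real_derivative_ray: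
  fixes F :: "real \<Rightarrow> real"
  assumes "(F has_real_derivative D) (at m)"
  shows "((\<lambda>\<epsilon>. (F (m + c * \<epsilon>) - F m) / \<epsilon>) \<longlongrightarrow> D * c) (at_right 0)"
proof -
  have "((\<lambda>\<epsilon>. F (m + c * \<epsilon>)) has_real_derivative D * c) (at 0)"
    by (rule DERIV_chain2[where f = F]) (use assms in \<open>auto intro!: derivative_eq_intros\<close>)
  then show ?thesis
    unfolding has_field_derivative_iff by (auto intro: tendsto_within_subset)
qed

lemma eventually_at_right_0_unit: "\<forall>\<^sub>F \<epsilon> in at_right (0::real). 0 < \<epsilon> \<and> \<epsilon> < 1"
  using eventually_at_right_real[of 0 "1::real"] by simp

section \<open>Influence functions and their second moments\<close>

context real_distribution
begin

text \<open>The law whose quantile is taken stays fixed; only the level moves, at rate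
  \<open>cdf M x - 1/2\<close>, and inverting the CDF divides this rate by \<open>k\<close>.\<close>

lemma has_IF_T_frozen:
  assumes cont: "continuous_on UNIV (cdf M)" and m: "m = cdf_inv M (1/2)"
    and deriv: "(cdf M has_real_derivative k) (at m)" and k: "k > 0"
  shows "has_IF (T_frozen M) M x ((cdf M x - 1/2) / k)"
proof -
  have Fm: "cdf M m = 1/2" using cdf_cdf_inv[OF cont] m by simp
  let ?u = "\<lambda>\<epsilon>. 1/2 + \<epsilon> * (cdf M x - 1/2)"
  have "((\<lambda>\<epsilon>. (cdf_inv M (?u \<epsilon>) - m) / \<epsilon>) \<longlongrightarrow> (cdf M x - 1/2) / k) (at_right 0)"
  proof (rule cdf_inv_slope_tendsto[where Q = "\<lambda>_. M" and u = ?u and l = "1/2" and k = k])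
    have "(?u \<longlongrightarrow> ?u 0) (at_right 0)"
      by (intro tendsto_add tendsto_mult tendsto_const tendsto_ident_at)
    then show "(?u \<longlongrightarrow> 1/2) (at_right 0)" by simp
    fix c
    have "((\<lambda>\<epsilon>. (cdf M (m + c * \<epsilon>) - cdf M m) / \<epsilon> - (cdf M x - 1/2)) \<longlongrightarrow> k * c - (cdf M x - 1/2)) (at_right 0)"
      by (intro tendsto_diff has_real_derivative_ray deriv tendsto_const)
    moreover have "k * c - (cdf M x - 1/2) = k * (c - (cdf M x - 1/2) / k)" using k by (simp add: field_simps)
    ultimately have "((\<lambda>\<epsilon>. (cdf M (m + c * \<epsilon>) - cdf M m) / \<epsilon> - (cdf M x - 1/2))
        \<longlongrightarrow> k * (c - (cdf M x - 1/2) / k)) (at_right 0)" by (rule tendsto_eq_rhs)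
    then show "((\<lambda>\<epsilon>. (cdf M (m + c * \<epsilon>) - ?u \<epsilon>) / \<epsilon>) \<longlongrightarrow> k * (c - (cdf M x - 1/2) / k)) (at_right 0)"
      by (rule Lim_transform_eventually)
        (use eventually_at_right_0_unit in eventually_elim, simp add: Fm field_simps)
  qed (use k in \<open>auto intro!: always_eventually real_distribution_axioms\<close>)
  then show ?thesis
    unfolding has_IF_def
    by (rule Lim_transform_eventually)
      (use eventually_at_right_0_unit in eventually_elim,
        simp add: T_frozen_def integral_contaminate_cdf[OF cont] expectation_cdf[OF cont] m)
qed

text \<open>The level shift \<open>a * \<epsilon>\<^sup>2\<close> vanishes after division by
  \<open>\<epsilon>\<close>, so one limit serves the median (\<open>a = 0\<close>) and the intrinsic
  functional (\<open>a = 1/2\<close>).\<close>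

lemma contaminate_quantile_slope:
  assumes cont: "continuous_on UNIV (cdf M)" and m: "m = cdf_inv M (1/2)"
    and deriv: "(cdf M has_real_derivative k) (at m)" and k: "k > 0" and x: "x \<noteq> m"
  shows "((\<lambda>\<epsilon>. (cdf_inv (contaminate M x \<epsilon>) (1/2 + a * \<epsilon>\<^sup>2) - m) / \<epsilon>)
    \<longlongrightarrow> (1/2 - indicator {..m} x) / k) (at_right 0)"
proof -
  have Fm: "cdf M m = 1/2" using cdf_cdf_inv[OF cont] m by simp
  let ?u = "\<lambda>\<epsilon>::real. 1/2 + a * \<epsilon>\<^sup>2" and ?Q = "contaminate M x"
  let ?v = "(1/2 - indicator {..m} x) / k :: real"
  show ?thesis
  proof (rule cdf_inv_slope_tendsto[where Q = ?Q and u = ?u and l = "1/2" and k = k])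
    show "\<forall>\<^sub>F \<epsilon> in at_right 0. real_distribution (?Q \<epsilon>)"
      using eventually_at_right_0_unit
      by eventually_elim (auto intro: real_distribution_contaminate[OF real_distribution_axioms])
    have "(?u \<longlongrightarrow> ?u 0) (at_right 0)"
      by (intro tendsto_add tendsto_mult tendsto_power tendsto_const tendsto_ident_at)
    then show "(?u \<longlongrightarrow> 1/2) (at_right 0)" by simp
    fix c
    have "((\<lambda>\<epsilon>. m + c * \<epsilon>) \<longlongrightarrow> m + c * 0) (at_right 0)"
      by (intro tendsto_add tendsto_mult tendsto_const tendsto_ident_at)
    then have ray: "((\<lambda>\<epsilon>. m + c * \<epsilon>) \<longlongrightarrow> m) (at_right 0)" by simp
    \<comment> \<open>As \<open>x \<noteq> m\<close>, the ray eventually stays on the same side of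
      \<open>x\<close> as \<open>m\<close>, so the atom contributes a constant. At
      \<open>x = m\<close> this would depend on the sign of \<open>c\<close>.\<close>
    have ind: "\<forall>\<^sub>F \<epsilon> in at_right 0. (indicator {..m + c * \<epsilon>} x :: real) = indicator {..m} x"
    proof (cases "x < m")
      case True
      from order_tendstoD(1)[OF ray this] show ?thesis
        by eventually_elim (use True in \<open>auto simp: indicator_def\<close>)
    next
      case False
      then have "m < x" using x by simp
      from order_tendstoD(2)[OF ray this] show ?thesis
        by eventually_elim (use \<open>m < x\<close> in \<open>auto simp: indicator_def\<close>)
    qed
    \<comment> \<open>The term \<open>-1/2\<close> is the loss of mass at the median:
      \<open>(1 - \<epsilon>) * cdf M m - 1/2 = -\<epsilon>/2\<close>.\<close>
    have "((\<lambda>\<epsilon>. (1 - \<epsilon>) * ((cdf M (m + c * \<epsilon>) - cdf M m) / \<epsilon>) - 1/2 + indicator {..m} x - a * \<epsilon>)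
        \<longlongrightarrow> (1 - 0) * (k * c) - 1/2 + indicator {..m} x - a * 0) (at_right 0)"
      by (intro tendsto_add tendsto_diff tendsto_mult tendsto_const tendsto_ident_at has_real_derivative_ray deriv)
    moreover have "(1 - 0) * (k * c) - 1/2 + indicator {..m} x - a * 0 = k * (c - ?v)"
      using k by (simp add: field_simps)
    ultimately have "((\<lambda>\<epsilon>. (1 - \<epsilon>) * ((cdf M (m + c * \<epsilon>) - cdf M m) / \<epsilon>) - 1/2 + indicator {..m} x - a * \<epsilon>)
        \<longlongrightarrow> k * (c - ?v)) (at_right 0)" by (rule tendsto_eq_rhs)
    then show "((\<lambda>\<epsilon>. (cdf (?Q \<epsilon>) (m + c * \<epsilon>) - ?u \<epsilon>) / \<epsilon>) \<longlongrightarrow> k * (c - ?v)) (at_right 0)"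
      by (rule Lim_transform_eventually)
        (use eventually_at_right_0_unit ind in eventually_elim,
          simp add: cdf_contaminate Fm field_simps power2_eq_square)
  qed (use k in auto)
qed

lemma has_IF_median:
  assumes "continuous_on UNIV (cdf M)" "m = cdf_inv M (1/2)"
    "(cdf M has_real_derivative k) (at m)" "k > 0" "x \<noteq> m"
  shows "has_IF median M x ((1/2 - indicator {..m} x) / k)"
  using contaminate_quantile_slope[OF assms, of 0] assms(2) by (simp add: has_IF_def median_def)

lemma has_IF_T_int:
  assumes "continuous_on UNIV (cdf M)" "m = cdf_inv M (1/2)"
    "(cdf M has_real_derivative k) (at m)" "k > 0" "x \<noteq> m"
  shows "has_IF T_int M x ((1/2 - indicator {..m} x) / k)"
  unfolding has_IF_def
  using contaminate_quantile_slope[OF assms, of "1/2"]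
  by (rule Lim_transform_eventually)
    (use eventually_at_right_0_unit in eventually_elim,
      simp add: T_int_def integral_contaminate_cdf_contaminate[OF assms(1)] expectation_cdf[OF assms(1)] assms(2))

text \<open>The influence function is \<open>F(X)\<close> centred at its mean and divided by
  \<open>k\<close>, so its second moment is the uniform variance over
  \<open>k\<^sup>2\<close>.\<close>

lemma has_bochner_integral_IF_frozen:
  assumes cont: "continuous_on UNIV (cdf M)"
    and IF: "\<And>x. has_IF T M x ((cdf M x - 1/2) / k)"
  shows "has_bochner_integral M (\<lambda>x. (IF T M x)\<^sup>2) (1 / (12 * k\<^sup>2))"
proof -
  have "(\<integral>x. (cdf M x - 1/2)\<^sup>2 \<partial>M) = 1/12"
    using variance_cdf[OF cont] by (simp add: expectation_cdf[OF cont])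
  moreover have "integrable M (\<lambda>x. (cdf M x - 1/2)\<^sup>2)"
  proof (rule integrable_bounded[of _ "1\<^sup>2"])
    show "\<bar>(cdf M x - 1/2)\<^sup>2\<bar> \<le> 1\<^sup>2" for x
      using cdf_nonneg[of x] cdf_bounded_prob[of x]
      unfolding abs_power2 by (intro abs_le_square_iff[THEN iffD1]) (simp add: abs_le_iff)
  qed simp
  ultimately have "has_bochner_integral M (\<lambda>x. (cdf M x - 1/2)\<^sup>2) (1/12)"
    by (simp add: has_bochner_integral_iff)
  from has_bochner_integral_divide[OF this, of "k\<^sup>2"] show ?thesis
    by (simp add: has_IF_imp_IF[OF IF] power_divide)
qed

text \<open>Off \<open>m\<close> the influence function only takes the values
  \<open>1/(2 * k)\<close> and \<open>-1/(2 * k)\<close>, so its square is constant, and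
  \<open>m\<close> is a null point since the CDF is continuous.\<close>

lemma has_bochner_integral_IF_median:
  assumes cont: "continuous_on UNIV (cdf M)"
    and IF: "\<And>x. x \<noteq> m \<Longrightarrow> has_IF T M x ((1/2 - indicator {..m} x) / k)"
  shows "has_bochner_integral M (\<lambda>x. (IF T M x)\<^sup>2) (1 / (4 * k\<^sup>2))"
proof -
  have off: "(IF T M x)\<^sup>2 = 1 / (4 * k\<^sup>2)" if "x \<noteq> m" for x
    using that by (simp add: has_IF_imp_IF[OF IF] power_divide power2_eq_square split: split_indicator)
  \<comment> \<open>Measurability must not depend on the value at \<open>m\<close>, which the
    premise \<open>IF\<close> leaves open: the square is a constant changed at one point.\<close>
  then have eq: "(\<lambda>x. (IF T M x)\<^sup>2) = (\<lambda>x. if x = m then (IF T M m)\<^sup>2 else 1 / (4 * k\<^sup>2))"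
    by (intro ext) presburger
  have "prob {m} = 0"
    using cont by (simp add: isCont_cdf[symmetric] continuous_on_eq_continuous_at)
  then have "AE x in M. x \<noteq> m"
    by (intro AE_I[of _ _ "{m}"]) (auto simp: emeasure_eq_measure)
  then have ae: "AE x in M. (IF T M x)\<^sup>2 = 1 / (4 * k\<^sup>2)"
    by eventually_elim (rule off)
  have "(\<lambda>x. (IF T M x)\<^sup>2) \<in> borel_measurable M"
    by (subst eq) measurable
  moreover have "has_bochner_integral M (\<lambda>x. 1 / (4 * k\<^sup>2)) (1 / (4 * k\<^sup>2))"
    using prob_space by (simp add: has_bochner_integral_iff)
  ultimately show ?thesis
    using has_bochner_integral_cong_AE[OF _ _ ae] by simp
qed

end

theorem proposition4p7:
  fixes P :: "real measure" and f :: "real \<Rightarrow> real" and m :: real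
  assumes "real_distribution P"
    and "continuous_on UNIV (cdf P)"
    and "m = cdf_inv P (1/2)"
    and "(cdf P has_real_derivative f m) (at m)"
    and "f m > 0"
  shows "(\<forall>x. has_IF (T_frozen P) P x ((cdf P x - 1/2) / f m))
    \<and> has_bochner_integral P (\<lambda>x. (IF (T_frozen P) P x)\<^sup>2) (1 / (12 * (f m)\<^sup>2))
    \<and> (\<forall>Q. real_distribution Q \<and> continuous_on UNIV (cdf Q) \<longrightarrow>
          integral\<^sup>L Q (cdf Q) = 1/2 \<and> T_int Q = median Q)
    \<and> (\<forall>T \<in> {T_int, median}.
          (\<forall>x. x \<noteq> m \<longrightarrow> has_IF T P x ((1/2 - indicator {..m} x) / f m))
        \<and> has_bochner_integral P (\<lambda>x. (IF T P x)\<^sup>2) (1 / (4 * (f m)\<^sup>2)))"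
proof -
  interpret P: real_distribution P by fact
  note hyps = assms(2-5)
  \<comment> \<open>Stated for both functionals at once, to supply the pointwise premise of the
    second-moment lemma for each.\<close>
  have med: "has_IF T P x ((1/2 - indicator {..m} x) / f m)" if "T \<in> {T_int, median}" "x \<noteq> m" for T x
    using that P.has_IF_T_int[OF hyps] P.has_IF_median[OF hyps] by auto
  show ?thesis
    using P.has_IF_T_frozen[OF hyps] P.has_bochner_integral_IF_frozen[OF hyps(1) P.has_IF_T_frozen[OF hyps]]
      real_distribution.expectation_cdf real_distribution.T_int_eq_median
      med P.has_bochner_integral_IF_median[OF hyps(1) med]
    by blast
qed

end
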